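(* Let $D$ be an $n\times n$ irreducible doubly stochastic matrix, and let $h:=h(D)$ and $n':=n/h$. Then $D$ is cyclic if and only if there exists an $n\times n$ permutation matrix $P$ such that \[ P^{\intercal}DP = K_{h} \otimes J_{n'} . \] Moreover, in that case, $D$ is cyclic of order $h$.
   Context: A square matrix is doubly stochastic if its entries are nonnegative reals and each row and column sums to $1$. A square matrix $A$ is reducible if there is a permutation matrix $P$ such that $P^{\intercal}AP=\begin{bmatrix} A_1 & 0 \\ A_3 & A_2 \end{bmatrix}$ with $A_1,A_2$ square (nonempty) blocks; otherwise it is irreducible. For a square matrix $A$, $h(A)$ is the number of eigenvalues of $A$ of modulus equal to the spectral radius $\rho(A)$, counted with multiplicity; for doubly stochastic $D$ one has $\rho(D)=1$. It is a known fact (Marcus, Minc, Moyls) that $h(D)$ divides $n$ when $D$ is an irreducible $n\times n$ doubly stochastic matrix. A matrix $A$ is cyclic of order $p$ if $p$ is a positive integer with $A^{p+1}=A$ and $A^{m+1}\neq A$ for all $1\leq m<p$; $A$ is cyclic if it is cyclic of order $p$ for some positive integer $p$. $J_k$ is the $k\times k$ matrix with all entries $1/k$. $A\otimes B$ is the Kronecker product, i.e. the block matrix with blocks $a_{ij}B$. $K_h$ is the $h\times h$ circular shift matrix, with entry $1$ in positions $(i,i+1)$ for $1\le i\le h-1$ and in position $(h,1)$, and $0$ elsewhere ($K_1=[1]$). *)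

theory Defs
  imports "Jordan_Normal_Form.Spectral_Radius"
begin

definition doubly_stochastic :: "real mat \<Rightarrow> bool" where
  "doubly_stochastic A \<longleftrightarrow> square_mat A \<and>
     (\<forall>i<dim_row A. \<forall>j<dim_row A. 0 \<le> A $$ (i, j)) \<and>
     (\<forall>i<dim_row A. (\<Sum>j<dim_row A. A $$ (i, j)) = 1) \<and>
     (\<forall>j<dim_row A. (\<Sum>i<dim_row A. A $$ (i, j)) = 1)"

definition permutation_mat :: "nat \<Rightarrow> 'a :: {zero, one} mat \<Rightarrow> bool" where
  "permutation_mat n P \<longleftrightarrow>
     (\<exists>\<sigma>. \<sigma> permutes {..<n} \<and> P = mat n n (\<lambda>(i, j). if i = \<sigma> j then 1 else 0))"

text \<open>The diagonal blocks are required to be nonempty, so every \<open>1 \<times> 1\<close> matrix is irreducible.\<close>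

definition reducible_mat :: "'a :: semiring_1 mat \<Rightarrow> bool" where
  "reducible_mat A \<longleftrightarrow>
     (\<exists>P k m A\<^sub>1 A\<^sub>2 A\<^sub>3. 0 < k \<and> 0 < m \<and> A \<in> carrier_mat (k + m) (k + m) \<and>
        permutation_mat (k + m) P \<and>
        A\<^sub>1 \<in> carrier_mat k k \<and> A\<^sub>2 \<in> carrier_mat m m \<and> A\<^sub>3 \<in> carrier_mat m k \<and>
        transpose_mat P * A * P = four_block_mat A\<^sub>1 (0\<^sub>m k m) A\<^sub>3 A\<^sub>2)"

definition irreducible_mat :: "'a :: semiring_1 mat \<Rightarrow> bool" where
  "irreducible_mat A \<longleftrightarrow> square_mat A \<and> \<not> reducible_mat A"

text \<open>Eigenvalues are counted with algebraic multiplicity, i.e. as roots of the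
  characteristic polynomial. A real matrix has to be embedded into the complex matrices first.\<close>

definition peripheral_count :: "complex mat \<Rightarrow> nat" where
  "peripheral_count A =
     (\<Sum>e \<in> {e \<in> spectrum A. cmod e = spectral_radius A}. order e (char_poly A))"

definition cyclic_mat_of_order :: "'a :: semiring_1 mat \<Rightarrow> nat \<Rightarrow> bool" where
  "cyclic_mat_of_order A p \<longleftrightarrow> square_mat A \<and> 0 < p \<and>
     A ^\<^sub>m (p + 1) = A \<and> (\<forall>m. 1 \<le> m \<and> m < p \<longrightarrow> A ^\<^sub>m (m + 1) \<noteq> A)"

definition cyclic_mat :: "'a :: semiring_1 mat \<Rightarrow> bool" where
  "cyclic_mat A \<longleftrightarrow> (\<exists>p. cyclic_mat_of_order A p)"

definition J_mat :: "nat \<Rightarrow> real mat" where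
  "J_mat k = mat k k (\<lambda>_. 1 / real k)"

text \<open>Indices start at \<open>0\<close>: the entries \<open>1\<close> are at \<open>(i, i + 1)\<close> for \<open>i + 1 < h\<close> and at
  \<open>(h - 1, 0)\<close>.\<close>

definition K_mat :: "nat \<Rightarrow> 'a :: {zero, one} mat" where
  "K_mat h = mat h h (\<lambda>(i, j). if j = i + 1 \<or> (i + 1 = h \<and> j = 0) then 1 else 0)"

definition kronecker_mat :: "'a :: times mat \<Rightarrow> 'a mat \<Rightarrow> 'a mat" where
  "kronecker_mat A B =
     mat (dim_row A * dim_row B) (dim_col A * dim_col B)
       (\<lambda>(i, j). A $$ (i div dim_row B, j div dim_col B) * B $$ (i mod dim_row B, j mod dim_col B))"

end

theory Submission
  imports Defs
begin

text \<open>
If \<open>D\<close> has order \<open>p\<close>, then \<open>E = D\<^sup>p\<close> is an idempotent doubly stochastic matrix. For a vector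
\<open>x\<close> with \<open>E x = x\<close> the sum \<open>\<Sum>i j. E\<^sub>i\<^sub>j (x\<^sub>i - x\<^sub>j)\<^sup>2\<close> vanishes; applied to the columns and rows of \<open>E\<close>,
this makes \<open>E\<^sub>i\<^sub>j > 0\<close> an equivalence relation with identical rows and columns along its classes. As
\<open>D = E D = D E\<close> and \<open>E = D D\<^sup>p\<^sup>-\<^sup>1 = D\<^sup>p\<^sup>-\<^sup>1 D\<close>, the matrix \<open>D\<close> induces an injective map on classes, which preserves
their size because row and column sums are \<open>1\<close>. Irreducibility forces a single orbit of classes, and
listing these one after the other along the orbit exhibits \<open>K\<^sub>d \<otimes> J\<^sub>m\<close>. That \<open>d = h(D)\<close> holds because the
Kronecker product of two Fourier matrices diagonalises \<open>K\<^sub>d \<otimes> J\<^sub>m\<close>, with \<open>d\<close> diagonal entries of modulus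
\<open>1\<close> and zeros otherwise.
\<close>

subsection \<open>Matrix powers, permutation similarity and Kronecker products\<close>

lemma index_mult_mat_sum:
  assumes "A \<in> carrier_mat n m" "B \<in> carrier_mat m k" "i < n" "j < k"
  shows "(A * B) $$ (i, j) = (\<Sum>l<m. A $$ (i, l) * B $$ (l, j))"
  using assms by (simp add: scalar_prod_def atLeast0LessThan)

lemma pow_mat_Suc_left:
  fixes A :: "'a :: semiring_1 mat"
  assumes "A \<in> carrier_mat n n"
  shows "A ^\<^sub>m Suc k = A * A ^\<^sub>m k"
proof (induction k)
  case (Suc k)
  have "A ^\<^sub>m Suc (Suc k) = (A * A ^\<^sub>m k) * A"
    using Suc by simp
  also have "\<dots> = A * (A ^\<^sub>m k * A)"
    using assms by (intro assoc_mult_mat) auto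
  finally show ?case by simp
qed (use assms in auto)

section \<open>Conjugation by permutation matrices as relabelling of indices\<close>

lemma permutation_sandwich:
  fixes A :: "'a :: semiring_1 mat"
  assumes \<sigma>: "\<sigma> permutes {..<n}" and A: "A \<in> carrier_mat n n"
    and P: "P = mat n n (\<lambda>(i, j). if i = \<sigma> j then 1 else 0)"
  shows "transpose_mat P * A * P = mat n n (\<lambda>(i, j). A $$ (\<sigma> i, \<sigma> j))"
proof (rule eq_matI)
  fix i j assume "i < dim_row (mat n n (\<lambda>(i, j). A $$ (\<sigma> i, \<sigma> j)))"
    "j < dim_col (mat n n (\<lambda>(i, j). A $$ (\<sigma> i, \<sigma> j)))"
  then have ij: "i < n" "j < n" by auto
  have \<sigma>ij: "\<sigma> i < n" "\<sigma> j < n"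
    using permutes_in_image[OF \<sigma>] ij by auto
  have Pc: "P \<in> carrier_mat n n" "transpose_mat P \<in> carrier_mat n n"
    by (auto simp: P)
  have 1: "(transpose_mat P * A) $$ (i, l) = A $$ (\<sigma> i, l)" if "l < n" for l
  proof -
    have "(transpose_mat P * A) $$ (i, l) = (\<Sum>k<n. transpose_mat P $$ (i, k) * A $$ (k, l))"
      using index_mult_mat_sum[OF Pc(2) A ij(1) that] .
    also have "\<dots> = (\<Sum>k<n. if k = \<sigma> i then A $$ (k, l) else 0)"
      using ij by (intro sum.cong) (auto simp: P)
    also have "\<dots> = A $$ (\<sigma> i, l)"
      using \<sigma>ij by simp
    finally show ?thesis .
  qed
  have "(transpose_mat P * A * P) $$ (i, j)
      = (\<Sum>l<n. (transpose_mat P * A) $$ (i, l) * P $$ (l, j))"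
    using index_mult_mat_sum[of "transpose_mat P * A" n n P n i j] Pc A ij by auto
  also have "\<dots> = (\<Sum>l<n. if l = \<sigma> j then A $$ (\<sigma> i, l) else 0)"
    using ij 1 by (intro sum.cong) (auto simp: P)
  also have "\<dots> = A $$ (\<sigma> i, \<sigma> j)"
    using \<sigma>ij by simp
  finally show "(transpose_mat P * A * P) $$ (i, j)
      = mat n n (\<lambda>(i, j). A $$ (\<sigma> i, \<sigma> j)) $$ (i, j)"
    using ij by simp
qed (auto simp: P)

text \<open>Relabelling the identity matrix by an injective map gives the identity again, so the
  transpose of \<open>P\<close> is its inverse. This similarity carries both the cyclic order and
  the eigenvalues over to \<open>B\<close>.\<close>

lemma permutation_similar:
  fixes A B :: "'a :: field mat"
  assumes P: "permutation_mat n P" and A: "A \<in> carrier_mat n n"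
    and B: "transpose_mat P * A * P = B"
  shows "similar_mat_wit A B P (transpose_mat P)"
proof -
  from P obtain \<sigma> where \<sigma>: "\<sigma> permutes {..<n}"
    and P_eq: "P = mat n n (\<lambda>(i, j). if i = \<sigma> j then 1 else 0)"
    unfolding permutation_mat_def by auto
  have Pc: "P \<in> carrier_mat n n" "transpose_mat P \<in> carrier_mat n n"
    by (auto simp: P_eq)
  have "transpose_mat P * P = transpose_mat P * 1\<^sub>m n * P"
    using Pc by auto
  also have "\<dots> = mat n n (\<lambda>(i, j). 1\<^sub>m n $$ (\<sigma> i, \<sigma> j))"
    by (rule permutation_sandwich[OF \<sigma> _ P_eq]) auto
  also have "\<dots> = 1\<^sub>m n"
    using permutes_in_image[OF \<sigma>] permutes_inj[OF \<sigma>, THEN injD]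
    by (intro eq_matI) auto
  finally have PtP: "transpose_mat P * P = 1\<^sub>m n" .
  then have PPt: "P * transpose_mat P = 1\<^sub>m n"
    using mat_mult_left_right_inverse Pc by blast
  have "P * (transpose_mat P * A * P) * transpose_mat P
      = (P * transpose_mat P) * A * (P * transpose_mat P)"
    using Pc A by (simp add: assoc_mult_mat[of _ n n _ n _ n])
  then have "A = P * B * transpose_mat P"
    using A by (simp add: PPt B)
  moreover have "B \<in> carrier_mat n n"
    using Pc A by (auto simp flip: B)
  ultimately show ?thesis
    using Pc PtP PPt A by (intro similar_mat_witI) auto
qed

lemma similar_pow_eq_iff:
  fixes A B :: "'a :: semiring_1 mat"
  assumes "similar_mat_wit A B P Q"
  shows "A ^\<^sub>m k = A \<longleftrightarrow> B ^\<^sub>m k = B"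
proof -
  \<comment> \<open>One implication for arbitrary similar matrices; the equivalence applies it to
    the given witness and to its inverse.\<close>
  have *: "C ^\<^sub>m k = C"
    if wit: "similar_mat_wit C D R S" and "D ^\<^sub>m k = D" for C D R S :: "'a mat"
    using similar_mat_wit_pow_id[OF wit, of k] similar_mat_witD(3)[OF refl wit] that(2) by metis
  show ?thesis
    by (rule iffI) (rule *[OF similar_mat_wit_sym[OF assms]] *[OF assms], assumption)+
qed

lemma cyclic_mat_of_order_similar:
  fixes A B :: "'a :: semiring_1 mat"
  assumes "similar_mat_wit A B P Q"
  shows "cyclic_mat_of_order A p \<longleftrightarrow> cyclic_mat_of_order B p"
proof -
  obtain n where "A \<in> carrier_mat n n" "B \<in> carrier_mat n n"
    using similar_mat_witD(4,5)[OF refl assms] by blast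
  then have "square_mat A" "square_mat B"
    by auto
  then show ?thesis
    unfolding cyclic_mat_of_order_def by (simp only: similar_pow_eq_iff[OF assms])
qed

text \<open>Ordering the indices with \<open>S\<close> first turns the vanishing entries from
  \<open>S\<close> to its complement into the upper right zero block. This is the form in which
  irreducibility is exploited for \<open>D\<close>.\<close>

lemma reducible_matI:
  fixes A :: "'a :: semiring_1 mat"
  assumes A: "A \<in> carrier_mat n n" and S: "S \<subseteq> {..<n}" "S \<noteq> {}" "S \<noteq> {..<n}"
    and zero: "\<And>i j. i \<in> S \<Longrightarrow> j < n \<Longrightarrow> j \<notin> S \<Longrightarrow> A $$ (i, j) = 0"
  shows "reducible_mat A"
proof -
  define k where "k = card S"
  define m where "m = n - k"
  have finS: "finite S"
    using S finite_subset by blast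
  have k: "0 < k"
    using S finS by (simp add: k_def card_gt_0_iff)
  have "k < n"
    using psubset_card_mono[of "{..<n}" S] S by (auto simp: k_def)
  then have m: "0 < m" "k + m = n"
    by (auto simp: m_def)
  obtain f where f: "bij_betw f {..<k} S"
    using ex_bij_betw_nat_finite[OF finS] by (auto simp: k_def atLeast0LessThan)
  have "card {k..<n} = card ({..<n} - S)"
    using card_Diff_subset[OF finS S(1)] by (simp add: k_def)
  then obtain g where g: "bij_betw g {k..<n} ({..<n} - S)"
    using finite_same_card_bij[of "{k..<n}" "{..<n} - S"] by auto
  \<comment> \<open>The values from \<open>n\<close> on are fixed points, as \<open>permutes\<close>
    demands.\<close>
  define \<sigma> where "\<sigma> i = (if i < k then f i else if i < n then g i else i)" for i
  have "bij_betw \<sigma> ({..<k} \<union> {k..<n}) (S \<union> ({..<n} - S))"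
  proof (rule bij_betw_combine)
    show "bij_betw \<sigma> {..<k} S"
      using f bij_betw_cong[of "{..<k}" \<sigma> f S] by (simp add: \<sigma>_def)
    show "bij_betw \<sigma> {k..<n} ({..<n} - S)"
      using g bij_betw_cong[of "{k..<n}" \<sigma> g "{..<n} - S"] by (simp add: \<sigma>_def)
  qed auto
  moreover have "{..<k} \<union> {k..<n} = {..<n}" "S \<union> ({..<n} - S) = {..<n}"
    using \<open>k < n\<close> S by auto
  ultimately have \<sigma>: "\<sigma> permutes {..<n}"
    using \<open>k < n\<close> by (intro bij_imp_permutes) (auto simp: \<sigma>_def)
  define P :: "'a mat" where "P = mat n n (\<lambda>(i, j). if i = \<sigma> j then 1 else 0)"
  have perm: "permutation_mat n P"
    using \<sigma> by (auto simp: permutation_mat_def P_def)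
  have fS: "\<sigma> i \<in> S" if "i < k" for i
    using f that by (auto simp: \<sigma>_def bij_betw_def)
  have gS: "\<sigma> i < n \<and> \<sigma> i \<notin> S" if "k \<le> i" "i < n" for i
  proof -
    have "g i \<in> {..<n} - S"
      using g that by (auto simp: bij_betw_def)
    then show ?thesis using that by (simp add: \<sigma>_def)
  qed
  let ?B = "mat n n (\<lambda>(i, j). A $$ (\<sigma> i, \<sigma> j))"
  let ?A1 = "mat k k (\<lambda>(i, j). ?B $$ (i, j))"
  let ?A2 = "mat m m (\<lambda>(i, j). ?B $$ (i + k, j + k))"
  let ?A3 = "mat m k (\<lambda>(i, j). ?B $$ (i + k, j))"
  have "?B = four_block_mat ?A1 (0\<^sub>m k m) ?A3 ?A2"
  proof (rule eq_matI)
    fix i j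
    assume "i < dim_row (four_block_mat ?A1 (0\<^sub>m k m) ?A3 ?A2)"
      "j < dim_col (four_block_mat ?A1 (0\<^sub>m k m) ?A3 ?A2)"
    then have ij: "i < k + m" "j < k + m" by auto
    have "A $$ (\<sigma> i, \<sigma> j) = 0" if "i < k" "k \<le> j"
      using fS[OF that(1)] gS[OF that(2)] ij m(2) zero by auto
    then show "?B $$ (i, j) = four_block_mat ?A1 (0\<^sub>m k m) ?A3 ?A2 $$ (i, j)"
      using ij m(2) by (cases "i < k"; cases "j < k") auto
  qed (use m(2) in auto)
  then have "transpose_mat P * A * P = four_block_mat ?A1 (0\<^sub>m k m) ?A3 ?A2"
    using permutation_sandwich[OF \<sigma> A P_def] by (rule trans[rotated])
  then have "0 < k \<and> 0 < m \<and> A \<in> carrier_mat (k + m) (k + m) \<and> permutation_mat (k + m) P \<and>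
      ?A1 \<in> carrier_mat k k \<and> ?A2 \<in> carrier_mat m m \<and> ?A3 \<in> carrier_mat m k \<and>
      transpose_mat P * A * P = four_block_mat ?A1 (0\<^sub>m k m) ?A3 ?A2"
    unfolding m(2) using k m(1) perm A by (intro conjI mat_carrier)
  then show ?thesis
    unfolding reducible_mat_def by (intro exI)
qed

section \<open>Kronecker products and their double indexing by quotient and remainder\<close>

lemma sum_div_mod:
  fixes f :: "nat \<Rightarrow> nat \<Rightarrow> 'a :: comm_monoid_add"
  shows "(\<Sum>k<a * b. f (k div b) (k mod b)) = (\<Sum>i<a. \<Sum>j<b. f i j)"
proof -
  have "(\<Sum>k<a * b. f (k div b) (k mod b))
      = (\<Sum>i<a. \<Sum>k\<in>{i * b..<i * b + b}. f (k div b) (k mod b))"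
    by (rule sum.nat_group[symmetric])
  also have "\<dots> = (\<Sum>i<a. \<Sum>j<b. f i j)"
  proof (rule sum.cong[OF refl])
    fix i
    have "(\<Sum>k\<in>{i * b..<i * b + b}. f (k div b) (k mod b))
        = (\<Sum>j\<in>{0..<b}. f ((j + i * b) div b) ((j + i * b) mod b))"
      using sum.shift_bounds_nat_ivl[of "\<lambda>k. f (k div b) (k mod b)" 0 "i * b" b]
      by (simp add: add.commute)
    also have "\<dots> = (\<Sum>j<b. f i j)"
      by (intro sum.cong) auto
    finally show "(\<Sum>k\<in>{i * b..<i * b + b}. f (k div b) (k mod b)) = (\<Sum>j<b. f i j)" .
  qed
  finally show ?thesis .
qed

lemma kronecker_carrier [simp, intro]:
  "A \<in> carrier_mat a b \<Longrightarrow> B \<in> carrier_mat c d \<Longrightarrow>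
    kronecker_mat A B \<in> carrier_mat (a * c) (b * d)"
  by (auto simp: kronecker_mat_def)

lemma index_kronecker:
  assumes "A \<in> carrier_mat a b" "B \<in> carrier_mat c d" "i < a * c" "j < b * d"
  shows "kronecker_mat A B $$ (i, j) = A $$ (i div c, j div d) * B $$ (i mod c, j mod d)"
  using assms by (auto simp: kronecker_mat_def)

text \<open>The mixed product rule: the inner index splits into quotient and remainder by
  \<open>d\<close>, and the resulting double sum factors into the two matrix products.\<close>

lemma kronecker_mult:
  fixes A :: "'a :: comm_semiring_0 mat"
  assumes A: "A \<in> carrier_mat a b" and B: "B \<in> carrier_mat c d"
    and A': "A' \<in> carrier_mat b a'" and B': "B' \<in> carrier_mat d c'"
  shows "kronecker_mat A B * kronecker_mat A' B' = kronecker_mat (A * A') (B * B')"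
proof (rule eq_matI)
  fix i j
  assume "i < dim_row (kronecker_mat (A * A') (B * B'))"
    "j < dim_col (kronecker_mat (A * A') (B * B'))"
  then have ij: "i < a * c" "j < a' * c'"
    using assms by (auto simp: kronecker_mat_def)
  then have "0 < c" "0 < c'" by (auto intro: Nat.gr0I)
  then have dm: "i div c < a" "i mod c < c" "j div c' < a'" "j mod c' < c'"
    using ij by (auto simp: less_mult_imp_div_less)
  have "(kronecker_mat A B * kronecker_mat A' B') $$ (i, j)
      = (\<Sum>k<b * d. kronecker_mat A B $$ (i, k) * kronecker_mat A' B' $$ (k, j))"
    using index_mult_mat_sum[OF kronecker_carrier[OF A B] kronecker_carrier[OF A' B'] ij] .
  also have "\<dots> = (\<Sum>k<b * d. (\<lambda>u v. (A $$ (i div c, u) * A' $$ (u, j div c'))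
      * (B $$ (i mod c, v) * B' $$ (v, j mod c'))) (k div d) (k mod d))"
    using ij by (intro sum.cong)
      (auto simp: index_kronecker[OF A B] index_kronecker[OF A' B'] mult_ac)
  also have "\<dots> = (\<Sum>u<b. \<Sum>v<d. (A $$ (i div c, u) * A' $$ (u, j div c'))
      * (B $$ (i mod c, v) * B' $$ (v, j mod c')))"
    by (rule sum_div_mod)
  also have "\<dots> = (\<Sum>u<b. A $$ (i div c, u) * A' $$ (u, j div c'))
      * (\<Sum>v<d. B $$ (i mod c, v) * B' $$ (v, j mod c'))"
    by (simp add: sum_product)
  also have "\<dots> = (A * A') $$ (i div c, j div c') * (B * B') $$ (i mod c, j mod c')"
    using index_mult_mat_sum[OF A A' dm(1,3)] index_mult_mat_sum[OF B B' dm(2,4)] by simp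
  also have "\<dots> = kronecker_mat (A * A') (B * B') $$ (i, j)"
    using index_kronecker[OF mult_carrier_mat[OF A A'] mult_carrier_mat[OF B B'] ij] by simp
  finally show "(kronecker_mat A B * kronecker_mat A' B') $$ (i, j)
      = kronecker_mat (A * A') (B * B') $$ (i, j)" .
qed (use assms in \<open>auto simp: kronecker_mat_def\<close>)

lemma kronecker_one:
  "kronecker_mat (1\<^sub>m a) (1\<^sub>m b) = (1\<^sub>m (a * b) :: 'a :: semiring_1 mat)"
proof (rule eq_matI)
  fix i j assume "i < dim_row (1\<^sub>m (a * b) :: 'a mat)" "j < dim_col (1\<^sub>m (a * b) :: 'a mat)"
  then have ij: "i < a * b" "j < a * b" by auto
  then have "0 < b" by (auto intro: Nat.gr0I)
  have "i = j" if "i div b = j div b" "i mod b = j mod b"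
    using that by (metis div_mult_mod_eq)
  then show "kronecker_mat (1\<^sub>m a) (1\<^sub>m b) $$ (i, j) = (1\<^sub>m (a * b) :: 'a mat) $$ (i, j)"
    using ij \<open>0 < b\<close> by (auto simp: kronecker_mat_def less_mult_imp_div_less)
qed (auto simp: kronecker_mat_def)

section \<open>Powers of the cyclic shift, of the averaging matrix and of their Kronecker
  product\<close>

lemma K_mat_carrier [simp, intro]: "K_mat d \<in> carrier_mat d d"
  by (simp add: K_mat_def)

lemma J_mat_carrier [simp, intro]: "J_mat m \<in> carrier_mat m m"
  by (simp add: J_mat_def)

text \<open>Successor modulo \<open>d\<close> absorbs the wrap-around of the last row, so later
  arguments avoid a case distinction.\<close>

lemma index_K_mat:
  assumes "i < d" "j < d"
  shows "K_mat d $$ (i, j) = (if j = Suc i mod d then 1 else 0)"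
proof (cases "Suc i = d")
  case False
  then have "Suc i mod d = Suc i" using assms by simp
  then show ?thesis using assms False by (auto simp: K_mat_def)
qed (use assms in \<open>auto simp: K_mat_def\<close>)

lemma K_mat_pow:
  "(K_mat d :: 'a :: semiring_1 mat) ^\<^sub>m k
    = mat d d (\<lambda>(i, j). if j = (i + k) mod d then 1 else 0)"
proof (induction k)
  case 0
  show ?case by (intro eq_matI) (auto simp: K_mat_def)
next
  case (Suc k)
  let ?M = "\<lambda>k. mat d d (\<lambda>(i, j). if j = (i + k) mod d then 1 else 0) :: 'a mat"
  have "?M k * K_mat d = ?M (Suc k)"
  proof (rule eq_matI)
    fix i j assume "i < dim_row (?M (Suc k))" "j < dim_col (?M (Suc k))"
    then have ij: "i < d" "j < d" by auto
    then have md: "(i + k) mod d < d" by auto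
    have "(?M k * K_mat d) $$ (i, j) = (\<Sum>l<d. ?M k $$ (i, l) * K_mat d $$ (l, j))"
      using ij by (intro index_mult_mat_sum) auto
    also have "\<dots> = (\<Sum>l<d. if l = (i + k) mod d then K_mat d $$ (l, j) else 0)"
      using ij by (intro sum.cong) auto
    also have "\<dots> = K_mat d $$ ((i + k) mod d, j)"
      using md by simp
    also have "\<dots> = ?M (Suc k) $$ (i, j)"
      using ij md by (simp add: index_K_mat mod_Suc_eq)
    finally show "(?M k * K_mat d) $$ (i, j) = ?M (Suc k) $$ (i, j)" .
  qed (auto simp: K_mat_def)
  then show ?case using Suc by simp
qed

lemma J_mat_idem: "J_mat m * J_mat m = J_mat m"
  by (intro eq_matI) (auto simp: J_mat_def scalar_prod_def)

text \<open>Only the shift factor moves, because \<open>J_mat m\<close> is idempotent. The exponent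
  is positive since the zeroth power of \<open>J_mat m\<close> is the identity.\<close>

lemma kronecker_K_J_pow:
  "kronecker_mat (K_mat d) (J_mat m) ^\<^sub>m Suc k = kronecker_mat (K_mat d ^\<^sub>m Suc k) (J_mat m)"
proof (induction k)
  case 0
  have "1\<^sub>m (d * m) * kronecker_mat (K_mat d) (J_mat m) = kronecker_mat (K_mat d) (J_mat m)"
    by (rule left_mult_one_mat) auto
  moreover have "dim_row (kronecker_mat (K_mat d) (J_mat m)) = d * m"
    by (simp add: kronecker_mat_def K_mat_def J_mat_def)
  ultimately show ?case by (simp add: K_mat_def)
next
  case (Suc k)
  have "kronecker_mat (K_mat d) (J_mat m) ^\<^sub>m Suc (Suc k)
      = kronecker_mat (K_mat d ^\<^sub>m Suc k) (J_mat m) * kronecker_mat (K_mat d) (J_mat m)"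
    using Suc by simp
  also have "\<dots> = kronecker_mat (K_mat d ^\<^sub>m Suc k * K_mat d) (J_mat m * J_mat m)"
    by (rule kronecker_mult[of _ d d _ m m _ d _ m]) (auto simp del: pow_mat.simps)
  finally show ?case by (simp add: J_mat_idem)
qed

lemma cyclic_kronecker_K_J:
  assumes d: "0 < d" and m: "0 < m"
  shows "cyclic_mat_of_order (kronecker_mat (K_mat d) (J_mat m)) d"
proof -
  let ?M = "kronecker_mat (K_mat d) (J_mat m)"
  have "?M ^\<^sub>m Suc d = ?M"
  proof -
    have "K_mat d ^\<^sub>m Suc d = (K_mat d :: real mat)"
    proof (rule eq_matI)
      fix i j assume "i < dim_row (K_mat d :: real mat)" "j < dim_col (K_mat d :: real mat)"
      then have ij: "i < d" "j < d" by (auto simp: K_mat_def)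
      have "(i + Suc d) mod d = Suc i mod d"
        using mod_add_self2[of "Suc i" d] by simp
      then show "(K_mat d ^\<^sub>m Suc d :: real mat) $$ (i, j) = K_mat d $$ (i, j)"
        unfolding K_mat_pow using ij by (simp add: index_K_mat)
    qed (simp_all add: K_mat_def)
    then show ?thesis unfolding kronecker_K_J_pow by simp
  qed
  moreover have "?M ^\<^sub>m Suc k \<noteq> ?M" if k: "1 \<le> k" "k < d" for k
  proof
    assume eq: "?M ^\<^sub>m Suc k = ?M"
    \<comment> \<open>Column \<open>j * m\<close> is the first column of the only nonzero block in
      the top block row of \<open>?M\<close>. Equality of the two powers there forces
      \<open>Suc k\<close> and \<open>1\<close> to agree modulo \<open>d\<close>.\<close>
    define j where "j = 1 mod d"
    have j: "j < d" "j * m < d * m"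
      using d m by (auto simp: j_def)
    have "kronecker_mat (K_mat d ^\<^sub>m Suc k) (J_mat m) $$ (0, j * m) = ?M $$ (0, j * m)"
      using eq unfolding kronecker_K_J_pow by simp
    then have "(K_mat d ^\<^sub>m Suc k :: real mat) $$ (0, j) = K_mat d $$ (0, j)"
      using j d m by (subst (asm) (1 2) index_kronecker[of _ d d _ m m])
        (auto simp: J_mat_def simp del: pow_mat.simps)
    moreover have "(K_mat d :: real mat) $$ (0, j) = 1"
      using index_K_mat[OF d j(1)] by (simp add: j_def)
    moreover have "(K_mat d ^\<^sub>m Suc k :: real mat) $$ (0, j) = (if j = Suc k mod d then 1 else 0)"
      unfolding K_mat_pow using d j by simp
    ultimately have "j = Suc k mod d"
      by (simp split: if_splits)
    then have "Suc 0 mod d = Suc k mod d"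
      by (simp add: j_def)
    then have "d dvd Suc k - Suc 0"
      by (subst mod_eq_dvd_iff_nat[symmetric]) auto
    then show False using k by (auto dest: dvd_imp_le)
  qed
  ultimately show ?thesis
    using d unfolding cyclic_mat_of_order_def
    by (auto simp: kronecker_mat_def K_mat_def J_mat_def)
qed

subsection \<open>Peripheral eigenvalues of \<open>K\<^sub>d \<otimes> J\<^sub>m\<close>\<close>

text \<open>Orders add over products, and a linear factor contributes one exactly at its own root.
  Algebraic multiplicity thus becomes a count in a list of eigenvalues.\<close>

lemma order_prod_list_linear:
  "order a (\<Prod>x\<leftarrow>xs. [:- x, 1:]) = count_list xs (a :: 'a :: field)"
proof (induction xs)
  case (Cons x xs)
  have nz: "(\<Prod>x\<leftarrow>xs. [:- x, 1:]) \<noteq> 0"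
    by (auto simp: prod_list_zero_iff)
  have "order a [:- x, 1:] = (if x = a then 1 else 0)"
    using order_power_n_n[of a 1] by (auto intro: order_0I)
  then show ?case
    using Cons nz order_mult[of "[:- x, 1:]" "\<Prod>x\<leftarrow>xs. [:- x, 1:]" a]
    by (auto simp del: mult_pCons_left mult_pCons_right)
qed simp

lemma poly_prod_list_linear_eq_0_iff:
  "poly (\<Prod>x\<leftarrow>xs. [:- x, 1:]) a = 0 \<longleftrightarrow> (a :: 'a :: field) \<in> set xs"
  by (induction xs) auto

text \<open>The diagonal of \<open>B\<close> lists the eigenvalues of \<open>A\<close> with
  multiplicity; the bound on it, attained at \<open>k\<close>, makes the spectral radius equal to
  \<open>1\<close>.\<close>

lemma peripheral_count_upper_triangular:
  assumes A: "A \<in> carrier_mat n n" and B: "B \<in> carrier_mat n n" "upper_triangular B"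
    and sim: "similar_mat A B"
    and le: "\<And>i. i < n \<Longrightarrow> cmod (B $$ (i, i)) \<le> 1"
    and ex: "k < n" "cmod (B $$ (k, k)) = 1"
  shows "peripheral_count A = card {i. i < n \<and> cmod (B $$ (i, i)) = 1}"
proof -
  let ?xs = "diag_mat B"
  have cp: "char_poly A = (\<Prod>x\<leftarrow>?xs. [:- x, 1:])"
    using char_poly_similar[OF sim] char_poly_upper_triangular[OF B] by simp
  have spec: "spectrum A = set ?xs"
    unfolding spectrum_root_char_poly[OF A] cp poly_prod_list_linear_eq_0_iff by simp
  have rad: "spectral_radius A = 1"
    unfolding spectral_radius_def spec
  proof (rule Max_eqI)
    show "1 \<in> cmod ` set ?xs"
      using ex B by (auto simp: diag_mat_def image_iff intro!: bexI[of _ k])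
  qed (use le B in \<open>auto simp: diag_mat_def\<close>)
  let ?ys = "filter (\<lambda>x. cmod x = 1) ?xs"
  have "peripheral_count A = (\<Sum>e\<in>set ?ys. count_list ?xs e)"
    unfolding peripheral_count_def rad spec cp order_prod_list_linear
    by (intro sum.cong) auto
  \<comment> \<open>Filtering keeps every occurrence of a value of modulus one, so the counts over
    the distinct values add up to the length of the filtered list.\<close>
  also have "\<dots> = (\<Sum>e\<in>set ?ys. count_list ?ys e)"
  proof (rule sum.cong[OF refl])
    fix e assume e: "e \<in> set ?ys"
    have "count_list (filter P xs) e = count_list xs e" if "P e" for P xs
      using that by (induction xs) auto
    then show "count_list ?xs e = count_list ?ys e"
      using e by auto
  qed
  also have "\<dots> = length ?ys"
    by (rule sum_count_set) auto
  also have "\<dots> = card {i. i < length ?xs \<and> cmod (?xs ! i) = 1}"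
    by (rule length_filter_conv_card)
  also have "{i. i < length ?xs \<and> cmod (?xs ! i) = 1} = {i. i < n \<and> cmod (B $$ (i, i)) = 1}"
    using B by (auto simp: diag_mat_def)
  finally show ?thesis .
qed

section \<open>Roots of unity and discrete Fourier matrices\<close>

definition root_unity :: "nat \<Rightarrow> complex" where
  "root_unity d = cis (2 * pi / real d)"

definition fourier_mat :: "nat \<Rightarrow> complex mat" where
  "fourier_mat d = mat d d (\<lambda>(i, j). root_unity d ^ (i * j))"

text \<open>The adjoint of the symmetric matrix \<open>fourier_mat d\<close>, scaled by
  \<open>1/d\<close>; conjugation is written as \<open>inverse\<close> because the entries have
  modulus one.\<close>

definition fourier_inv_mat :: "nat \<Rightarrow> complex mat" where
  "fourier_inv_mat d = mat d d (\<lambda>(i, j). inverse (root_unity d ^ (i * j)) / of_nat d)"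

lemma fourier_carrier [simp, intro]:
  "fourier_mat d \<in> carrier_mat d d" "fourier_inv_mat d \<in> carrier_mat d d"
  by (simp_all add: fourier_mat_def fourier_inv_mat_def)

lemma root_unity_power_self: "0 < d \<Longrightarrow> root_unity d ^ d = 1"
  by (simp add: root_unity_def DeMoivre)

lemma norm_root_unity_power [simp]: "cmod (root_unity d ^ k) = 1"
  by (simp add: root_unity_def norm_power)

lemma root_unity_nonzero [simp]: "root_unity d \<noteq> 0"
  by (simp add: root_unity_def)

lemma root_unity_power_mod:
  assumes "0 < d"
  shows "root_unity d ^ (k mod d) = root_unity d ^ k"
proof -
  have "root_unity d ^ k = root_unity d ^ (d * (k div d) + k mod d)"
    by simp
  also have "\<dots> = root_unity d ^ (k mod d)"
    unfolding power_add power_mult using assms by (simp add: root_unity_power_self)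
  finally show ?thesis ..
qed

lemma root_unity_power_inj:
  assumes "root_unity d ^ i = root_unity d ^ j" "i < d" "j < d"
  shows "i = j"
proof -
  have "inj_on (\<lambda>k. cis (2 * pi * real k / real d)) {..<d}"
    using bij_betw_roots_unity[of d] assms by (auto simp: bij_betw_def)
  moreover have "root_unity d ^ k = cis (2 * pi * real k / real d)" for k
    by (simp add: root_unity_def DeMoivre mult_ac)
  ultimately show ?thesis
    using assms by (auto simp: inj_on_def)
qed

text \<open>Orthogonality of the characters of the cyclic group: off the diagonal the sum is
  geometric, with a ratio different from \<open>1\<close> whose \<open>d\<close>-th power is
  \<open>1\<close>.\<close>

lemma sum_root_unity_quotient:
  assumes "i < d" "j < d"
  shows "(\<Sum>k<d. root_unity d ^ (i * k) * inverse (root_unity d ^ (k * j)))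
    = (if i = j then of_nat d else 0)"
proof -
  let ?z = "root_unity d ^ i / root_unity d ^ j"
  have "(\<Sum>k<d. root_unity d ^ (i * k) * inverse (root_unity d ^ (k * j))) = (\<Sum>k<d. ?z ^ k)"
    by (simp add: power_mult power_divide divide_inverse mult.commute[of _ j] power_mult_distrib
      flip: power_inverse)
  also have "\<dots> = (if i = j then of_nat d else 0)"
  proof (cases "i = j")
    case False
    then have "?z \<noteq> 1"
      using root_unity_power_inj assms by auto
    moreover have "(root_unity d ^ k) ^ d = 1" for k
    proof -
      have "(root_unity d ^ k) ^ d = (root_unity d ^ d) ^ k"
        by (simp only: power_mult[symmetric] mult.commute)
      then show ?thesis
        using assms by (simp add: root_unity_power_self)
    qed
    then have "?z ^ d = 1"
      by (simp add: power_divide)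
    ultimately show ?thesis
      using False by (simp add: geometric_sum)
  qed simp
  finally show ?thesis .
qed

lemma fourier_inverse:
  "fourier_mat d * fourier_inv_mat d = 1\<^sub>m d" "fourier_inv_mat d * fourier_mat d = 1\<^sub>m d"
proof -
  show *: "fourier_mat d * fourier_inv_mat d = 1\<^sub>m d"
  proof (rule eq_matI)
    fix i j assume "i < dim_row (1\<^sub>m d :: complex mat)" "j < dim_col (1\<^sub>m d :: complex mat)"
    then have ij: "i < d" "j < d" by auto
    have "(fourier_mat d * fourier_inv_mat d) $$ (i, j)
        = (\<Sum>k<d. fourier_mat d $$ (i, k) * fourier_inv_mat d $$ (k, j))"
      using ij by (intro index_mult_mat_sum) auto
    also have "\<dots> = (\<Sum>k<d. root_unity d ^ (i * k) * inverse (root_unity d ^ (k * j))) / of_nat d"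
      unfolding sum_divide_distrib using ij
      by (intro sum.cong) (auto simp: fourier_mat_def fourier_inv_mat_def)
    also have "\<dots> = 1\<^sub>m d $$ (i, j)"
      unfolding sum_root_unity_quotient[OF ij] using ij by simp
    finally show "(fourier_mat d * fourier_inv_mat d) $$ (i, j) = 1\<^sub>m d $$ (i, j)" .
  qed (auto simp: fourier_mat_def fourier_inv_mat_def)
  show "fourier_inv_mat d * fourier_mat d = 1\<^sub>m d"
    by (rule mat_mult_left_right_inverse[OF _ _ *]) auto
qed

text \<open>Shifting the rows multiplies column \<open>j\<close> by \<open>root_unity d ^ j\<close>;
  the wrap-around is consistent because \<open>root_unity d ^ d = 1\<close>.\<close>

lemma fourier_diagonalises_K:
  "K_mat d * fourier_mat d
    = fourier_mat d * mat d d (\<lambda>(i, j). if i = j then root_unity d ^ i else 0)"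
  (is "_ = _ * ?D")
proof (rule eq_matI)
  fix i j assume "i < dim_row (fourier_mat d * ?D)" "j < dim_col (fourier_mat d * ?D)"
  then have ij: "i < d" "j < d" by (auto simp: fourier_mat_def)
  then have s: "Suc i mod d < d" by auto
  have "(K_mat d * fourier_mat d) $$ (i, j) = (\<Sum>k<d. K_mat d $$ (i, k) * fourier_mat d $$ (k, j))"
    using ij by (intro index_mult_mat_sum) auto
  also have "\<dots> = (\<Sum>k<d. if k = Suc i mod d then fourier_mat d $$ (k, j) else 0)"
    using ij by (intro sum.cong) (auto simp: index_K_mat)
  also have "\<dots> = (root_unity d ^ (Suc i mod d)) ^ j"
    using s ij by (simp add: fourier_mat_def power_mult)
  also have "\<dots> = root_unity d ^ (i * j) * root_unity d ^ j"
    using ij by (simp add: root_unity_power_mod power_mult_distrib power_mult mult.commute)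
  also have "\<dots> = (\<Sum>k<d. if k = j then root_unity d ^ (i * k) * root_unity d ^ k else 0)"
    using ij by simp
  also have "\<dots> = (\<Sum>k<d. fourier_mat d $$ (i, k) * ?D $$ (k, j))"
    using ij by (intro sum.cong) (auto simp: fourier_mat_def)
  also have "\<dots> = (fourier_mat d * ?D) $$ (i, j)"
    using ij by (intro index_mult_mat_sum[symmetric]) auto
  finally show "(K_mat d * fourier_mat d) $$ (i, j) = (fourier_mat d * ?D) $$ (i, j)" .
qed (auto simp: K_mat_def fourier_mat_def)

text \<open>\<open>J_mat m\<close> replaces each column by its mean, which is \<open>1\<close> for
  the all-ones column \<open>0\<close> and vanishes for the others by orthogonality.\<close>

lemma fourier_diagonalises_J:
  "map_mat complex_of_real (J_mat m) * fourier_mat m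
    = fourier_mat m * mat m m (\<lambda>(i, j). if i = 0 \<and> j = 0 then 1 else 0)"
  (is "?J * _ = _ * ?D")
proof (rule eq_matI)
  fix i j assume "i < dim_row (fourier_mat m * ?D)" "j < dim_col (fourier_mat m * ?D)"
  then have ij: "i < m" "j < m" by (auto simp: fourier_mat_def)
  have "(?J * fourier_mat m) $$ (i, j) = (\<Sum>k<m. ?J $$ (i, k) * fourier_mat m $$ (k, j))"
    using ij by (intro index_mult_mat_sum) auto
  \<comment> \<open>The factor with \<open>k * 0\<close> equals \<open>1\<close>; it brings the sum
    into the shape of the orthogonality relation between \<open>j\<close> and
    \<open>0\<close>.\<close>
  also have "\<dots> = (\<Sum>k<m. root_unity m ^ (j * k) * inverse (root_unity m ^ (k * 0))) / of_nat m"
    unfolding sum_divide_distrib using ij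
    by (intro sum.cong) (auto simp: J_mat_def fourier_mat_def mult.commute)
  also have "\<dots> = (if j = 0 then 1 else 0)"
    using sum_root_unity_quotient[of j m 0] ij by simp
  also have "\<dots> = (\<Sum>k<m. if k = 0 then root_unity m ^ (i * k) * (if j = 0 then 1 else 0) else 0)"
    using ij by simp
  also have "\<dots> = (\<Sum>k<m. fourier_mat m $$ (i, k) * ?D $$ (k, j))"
    using ij by (intro sum.cong) (auto simp: fourier_mat_def)
  also have "\<dots> = (fourier_mat m * ?D) $$ (i, j)"
    using ij by (intro index_mult_mat_sum[symmetric]) auto
  finally show "(?J * fourier_mat m) $$ (i, j) = (fourier_mat m * ?D) $$ (i, j)" .
qed (auto simp: J_mat_def fourier_mat_def)

lemma map_kronecker_K_J:
  "map_mat complex_of_real (kronecker_mat (K_mat d) (J_mat m))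
    = kronecker_mat (K_mat d) (map_mat complex_of_real (J_mat m))"
proof (rule eq_matI)
  let ?J = "map_mat complex_of_real (J_mat m)"
  fix i j assume "i < dim_row (kronecker_mat (K_mat d) ?J)" "j < dim_col (kronecker_mat (K_mat d) ?J)"
  then have ij: "i < d * m" "j < d * m"
    by (auto simp: kronecker_mat_def K_mat_def J_mat_def)
  then have "0 < m" by (auto intro: Nat.gr0I)
  then have dm: "i div m < d" "j div m < d" "i mod m < m" "j mod m < m"
    using ij by (auto simp: less_mult_imp_div_less)
  have "map_mat complex_of_real (kronecker_mat (K_mat d) (J_mat m)) $$ (i, j)
      = complex_of_real (K_mat d $$ (i div m, j div m) * J_mat m $$ (i mod m, j mod m))"
    using ij carrier_matD[OF kronecker_carrier[OF K_mat_carrier J_mat_carrier], of d m]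
    by (simp add: index_kronecker[OF K_mat_carrier J_mat_carrier ij] del: of_real_mult)
  also have "\<dots> = K_mat d $$ (i div m, j div m) * ?J $$ (i mod m, j mod m)"
    using dm by (simp add: index_K_mat J_mat_def)
  also have "\<dots> = kronecker_mat (K_mat d) ?J $$ (i, j)"
    by (rule index_kronecker[symmetric, OF K_mat_carrier _ ij]) auto
  finally show "map_mat complex_of_real (kronecker_mat (K_mat d) (J_mat m)) $$ (i, j)
      = kronecker_mat (K_mat d) ?J $$ (i, j)" .
qed (auto simp: kronecker_mat_def K_mat_def J_mat_def)

text \<open>The mixed product rule combines both diagonalisations into the diagonal matrix
  \<open>?L\<close>. The claim concerns any \<open>A\<close> similar to the Kronecker product, so
  that it applies to \<open>D\<close> itself.\<close>

lemma peripheral_count_kronecker: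
  assumes d: "0 < d" and m: "0 < m"
    and sim: "similar_mat A (map_mat complex_of_real (kronecker_mat (K_mat d) (J_mat m)))"
  shows "peripheral_count A = d"
proof -
  let ?J = "map_mat complex_of_real (J_mat m)"
  let ?D = "mat d d (\<lambda>(i, j). if i = j then root_unity d ^ i else 0)"
  let ?E = "mat m m (\<lambda>(i, j). if i = 0 \<and> j = 0 then 1 else 0) :: complex mat"
  let ?M = "kronecker_mat (K_mat d) ?J"
  let ?F = "kronecker_mat (fourier_mat d) (fourier_mat m)"
  let ?G = "kronecker_mat (fourier_inv_mat d) (fourier_inv_mat m)"
  let ?L = "kronecker_mat ?D ?E"
  have c: "?M \<in> carrier_mat (d * m) (d * m)" "?F \<in> carrier_mat (d * m) (d * m)"
    "?G \<in> carrier_mat (d * m) (d * m)" "?L \<in> carrier_mat (d * m) (d * m)"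
    by (intro kronecker_carrier; auto)+
  have FG: "?F * ?G = 1\<^sub>m (d * m)" "?G * ?F = 1\<^sub>m (d * m)"
    using kronecker_mult[OF fourier_carrier(1)[of d] fourier_carrier(1)[of m]
        fourier_carrier(2)[of d] fourier_carrier(2)[of m]]
      kronecker_mult[OF fourier_carrier(2)[of d] fourier_carrier(2)[of m]
        fourier_carrier(1)[of d] fourier_carrier(1)[of m]]
    by (simp_all add: fourier_inverse kronecker_one)
  have "?M * ?F = kronecker_mat (K_mat d * fourier_mat d) (?J * fourier_mat m)"
    by (rule kronecker_mult[of _ d d _ m m _ d _ m]) auto
  also have "\<dots> = ?F * ?L"
    unfolding fourier_diagonalises_K fourier_diagonalises_J
    by (rule kronecker_mult[symmetric, of _ d d _ m m _ d _ m]) auto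
  finally have MF: "?M * ?F = ?F * ?L" .
  have "?M = ?M * (?F * ?G)"
    unfolding FG by (rule right_mult_one_mat[OF c(1), symmetric])
  also have "\<dots> = ?F * ?L * ?G"
    unfolding assoc_mult_mat[OF c(1-3), symmetric] MF ..
  finally have "similar_mat_wit ?M ?L ?F ?G"
    using FG c by (intro similar_mat_witI)
  then have "similar_mat ?M ?L"
    unfolding similar_mat_def by (intro exI)
  with sim have simL: "similar_mat A ?L"
    unfolding map_kronecker_K_J by (rule similar_mat_trans)
  have idx: "?L $$ (i, j) = (if i div m = j div m then root_unity d ^ (i div m) else 0)
      * (if i mod m = 0 \<and> j mod m = 0 then 1 else 0)" if "i < d * m" "j < d * m" for i j
    using that m by (simp add: kronecker_mat_def less_mult_imp_div_less)
  have ut: "upper_triangular ?L"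
  proof (rule upper_triangularI)
    fix i j assume "j < i" "i < dim_row ?L"
    then have "i < d * m" "j < d * m" by (auto simp: kronecker_mat_def)
    moreover have "\<not> (i div m = j div m \<and> i mod m = 0 \<and> j mod m = 0)"
      using \<open>j < i\<close> by (metis div_mult_mod_eq less_irrefl)
    ultimately show "?L $$ (i, j) = 0"
      by (auto simp: idx)
  qed
  \<comment> \<open>\<open>similar_mat\<close> hides the dimension, which is recovered from its
    witnesses.\<close>
  have "A \<in> carrier_mat (d * m) (d * m)"
  proof -
    from similar_matD[OF simL] obtain N P Q where N: "{A, ?L, P, Q} \<subseteq> carrier_mat N N"
      by blast
    then have "N = d * m"
      using carrier_matD(1)[OF c(4)] by (auto simp only: insert_subset carrier_matD(1))
    then show ?thesis
      using N by (simp only: insert_subset)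
  qed
  then have "peripheral_count A = card {i. i < d * m \<and> cmod (?L $$ (i, i)) = 1}"
  proof (rule peripheral_count_upper_triangular[OF _ c(4) ut simL])
    show "0 < d * m" "cmod (?L $$ (0, 0)) = 1"
      using d m by (simp_all add: idx)
    show "cmod (?L $$ (i, i)) \<le> 1" if "i < d * m" for i
      using that by (simp add: idx)
  qed
  \<comment> \<open>The second factor has its only nonzero diagonal entry at \<open>0\<close>, so
    exactly the multiples of \<open>m\<close> survive.\<close>
  also have "{i. i < d * m \<and> cmod (?L $$ (i, i)) = 1} = (\<lambda>k. k * m) ` {..<d}"
  proof (intro equalityI subsetI)
    fix i assume "i \<in> {i. i < d * m \<and> cmod (?L $$ (i, i)) = 1}"
    then have "i < d * m" "i mod m = 0"
      by (auto simp: idx norm_mult split: if_splits)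
    then show "i \<in> (\<lambda>k. k * m) ` {..<d}"
      by (intro image_eqI[of _ _ "i div m"]) (auto simp: less_mult_imp_div_less)
  qed (use m in \<open>auto simp: idx norm_mult\<close>)
  also have "card \<dots> = d"
    using m by (subst card_image) (auto simp: inj_on_def)
  finally show ?thesis .
qed

subsection \<open>Cyclic doubly stochastic matrices\<close>

text \<open>Similarity is found over the reals while \<open>peripheral_count\<close> is complex; the
  entrywise embedding respects products and identities.\<close>

lemma similar_mat_wit_of_real:
  assumes "similar_mat_wit A B P Q"
  shows "similar_mat_wit (map_mat complex_of_real A) (map_mat complex_of_real B)
    (map_mat complex_of_real P) (map_mat complex_of_real Q)"
proof -
  obtain n where n: "A \<in> carrier_mat n n" by (rule that[OF similar_mat_witD(4)[OF refl assms]])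
  note wit = similar_mat_witD2[OF n assms]
  note hom = of_real_hom.mat_hom_mult
  show ?thesis
  proof (rule similar_mat_witI)
    show "map_mat complex_of_real P * map_mat complex_of_real Q = 1\<^sub>m n"
      "map_mat complex_of_real Q * map_mat complex_of_real P = 1\<^sub>m n"
      using hom[OF wit(6,7)] hom[OF wit(7,6)] wit(1,2) of_real_hom.mat_hom_one by metis+
    show "map_mat complex_of_real A
        = map_mat complex_of_real P * map_mat complex_of_real B * map_mat complex_of_real Q"
      using hom[OF mult_carrier_mat[OF wit(6,5)] wit(7)] hom[OF wit(6,5)] wit(3) by metis
  qed (simp_all add: wit(4-7))
qed

section \<open>Doubly stochastic matrices: closure under products, and vectors constant along
  positive entries\<close>

lemma doubly_stochasticD:
  assumes "doubly_stochastic A" "A \<in> carrier_mat n n"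
  shows "\<And>i j. i < n \<Longrightarrow> j < n \<Longrightarrow> 0 \<le> A $$ (i, j)"
    and "\<And>i. i < n \<Longrightarrow> (\<Sum>j<n. A $$ (i, j)) = 1"
    and "\<And>j. j < n \<Longrightarrow> (\<Sum>i<n. A $$ (i, j)) = 1"
  using assms by (auto simp: doubly_stochastic_def)

lemma doubly_stochastic_mult:
  assumes A: "A \<in> carrier_mat n n" "doubly_stochastic A"
    and B: "B \<in> carrier_mat n n" "doubly_stochastic B"
  shows "doubly_stochastic (A * B)"
proof -
  note [simp] = doubly_stochasticD[OF A(2,1)] doubly_stochasticD[OF B(2,1)]
  have idx: "(A * B) $$ (i, j) = (\<Sum>l<n. A $$ (i, l) * B $$ (l, j))" if "i < n" "j < n" for i j
    using index_mult_mat_sum[OF A(1) B(1) that] .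
  have "0 \<le> (A * B) $$ (i, j)" if "i < n" "j < n" for i j
    unfolding idx[OF that] using that by (intro sum_nonneg mult_nonneg_nonneg) auto
  moreover have "(\<Sum>j<n. (A * B) $$ (i, j)) = 1" if "i < n" for i
  proof -
    have "(\<Sum>j<n. (A * B) $$ (i, j)) = (\<Sum>j<n. \<Sum>l<n. A $$ (i, l) * B $$ (l, j))"
      using that by (intro sum.cong) (simp_all add: idx del: index_mult_mat)
    also have "\<dots> = (\<Sum>l<n. A $$ (i, l) * (\<Sum>j<n. B $$ (l, j)))"
      unfolding sum_distrib_left by (rule sum.swap)
    also have "\<dots> = 1"
      using that by simp
    finally show ?thesis .
  qed
  moreover have "(\<Sum>i<n. (A * B) $$ (i, j)) = 1" if "j < n" for j
  proof -
    have "(\<Sum>i<n. (A * B) $$ (i, j)) = (\<Sum>i<n. \<Sum>l<n. A $$ (i, l) * B $$ (l, j))"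
      using that by (intro sum.cong) (simp_all add: idx del: index_mult_mat)
    also have "\<dots> = (\<Sum>l<n. (\<Sum>i<n. A $$ (i, l)) * B $$ (l, j))"
      unfolding sum_distrib_right by (rule sum.swap)
    also have "\<dots> = 1"
      using that by simp
    finally show ?thesis .
  qed
  ultimately show ?thesis
    using A(1) B(1) unfolding doubly_stochastic_def by (simp del: index_mult_mat(1))
qed

lemma doubly_stochastic_pow:
  assumes "A \<in> carrier_mat n n" "doubly_stochastic A"
  shows "doubly_stochastic (A ^\<^sub>m k)"
proof (induction k)
  case 0
  have "(\<Sum>j<n. 1\<^sub>m n $$ (i, j)) = (1 :: real)" "(\<Sum>j<n. 1\<^sub>m n $$ (j, i)) = (1 :: real)"
    if "i < n" for i
  proof -
    have "(\<Sum>j<n. 1\<^sub>m n $$ (i, j)) = (\<Sum>j<n. if j = i then 1 else 0 :: real)"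
      "(\<Sum>j<n. 1\<^sub>m n $$ (j, i)) = (\<Sum>j<n. if j = i then 1 else 0 :: real)"
      using that by (intro sum.cong; simp)+
    then show "(\<Sum>j<n. 1\<^sub>m n $$ (i, j)) = (1 :: real)" "(\<Sum>j<n. 1\<^sub>m n $$ (j, i)) = (1 :: real)"
      using that by simp_all
  qed
  then show ?case
    using assms(1) by (simp add: doubly_stochastic_def)
next
  case (Suc k)
  then show ?case
    using doubly_stochastic_mult[OF pow_carrier_mat[OF assms(1)] _ assms] by simp
qed

text \<open>The hypothesis makes the Dirichlet form \<open>\<Sum>i j. E\<^sub>i\<^sub>j (x\<^sub>i - x\<^sub>j)\<^sup>2\<close> vanish.\<close>

lemma doubly_stochastic_fixed_constant:
  fixes x :: "nat \<Rightarrow> real"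
  assumes E: "E \<in> carrier_mat n n" "doubly_stochastic E"
    and x: "(\<Sum>i<n. \<Sum>j<n. x i * E $$ (i, j) * x j) = (\<Sum>i<n. (x i)\<^sup>2)"
    and ij: "i < n" "j < n" "0 < E $$ (i, j)"
  shows "x i = x j"
proof -
  note ds = doubly_stochasticD[OF E(2,1)]
  \<comment> \<open>Expanding the square, the unit row and column sums reduce the two square terms
    to the sum of the \<open>x i\<close> squared, and the cross term is the hypothesis.\<close>
  have "(\<Sum>i<n. \<Sum>j<n. E $$ (i, j) * (x i - x j)\<^sup>2)
      = (\<Sum>i<n. \<Sum>j<n. E $$ (i, j) * (x i)\<^sup>2) + (\<Sum>i<n. \<Sum>j<n. E $$ (i, j) * (x j)\<^sup>2)
        - 2 * (\<Sum>i<n. \<Sum>j<n. x i * E $$ (i, j) * x j)"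
    unfolding sum_distrib_left sum.distrib[symmetric] sum_subtractf[symmetric]
    by (intro sum.cong refl) (simp add: power2_eq_square algebra_simps)
  also have "(\<Sum>i<n. \<Sum>j<n. E $$ (i, j) * (x i)\<^sup>2) = (\<Sum>i<n. (x i)\<^sup>2)"
    using ds(2) by (simp flip: sum_distrib_right)
  also have "(\<Sum>i<n. \<Sum>j<n. E $$ (i, j) * (x j)\<^sup>2) = (\<Sum>j<n. \<Sum>i<n. E $$ (i, j) * (x j)\<^sup>2)"
    by (rule sum.swap)
  also have "\<dots> = (\<Sum>i<n. (x i)\<^sup>2)"
    using ds(3) by (simp flip: sum_distrib_right)
  finally have "(\<Sum>i<n. \<Sum>j<n. E $$ (i, j) * (x i - x j)\<^sup>2) = 0"
    using x by simp
  then have "\<forall>i<n. (\<Sum>j<n. E $$ (i, j) * (x i - x j)\<^sup>2) = 0"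
    using ds(1) by (subst (asm) sum_nonneg_eq_0_iff) (auto intro!: sum_nonneg)
  then have "(\<Sum>j<n. E $$ (i, j) * (x i - x j)\<^sup>2) = 0"
    using ij by simp
  then have "\<forall>j\<in>{..<n}. E $$ (i, j) * (x i - x j)\<^sup>2 = 0"
    using ds(1) ij(1) by (subst (asm) sum_nonneg_eq_0_iff) auto
  then have "E $$ (i, j) * (x i - x j)\<^sup>2 = 0"
    using ij(2) by blast
  then show ?thesis
    using ij(3) by simp
qed

section \<open>The idempotent power of \<open>D\<close> and its equivalence classes\<close>

locale cyclic_doubly_stochastic =
  fixes D :: "real mat" and n p :: nat
  assumes D [simp, intro]: "D \<in> carrier_mat n n"
    and D_ds: "doubly_stochastic D"
    and D_irreducible: "irreducible_mat D"
    and n_pos: "0 < n" and p_pos: "0 < p"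
    and D_cyclic: "D ^\<^sub>m Suc p = D"
begin

abbreviation "E \<equiv> D ^\<^sub>m p"

text \<open>\<open>F\<close> acts as an inverse of \<open>D\<close> relative to \<open>E\<close>:
  both products are \<open>E\<close>. For \<open>p = 1\<close> it is the identity matrix.\<close>

abbreviation "F \<equiv> D ^\<^sub>m (p - 1)"

lemma E_products: "D * E = D" "E * D = D" "D * F = E" "F * D = E" "E * E = E"
proof -
  show "D * E = D" "E * D = D"
    using pow_mat_Suc_left[OF D, of p] D_cyclic by simp_all
  show DF: "D * F = E" and "F * D = E"
    using pow_mat_Suc_left[OF D, of "p - 1"] pow_mat.simps(2)[of D "p - 1"] p_pos by simp_all
  have "E * E = E * D * F"
    using assoc_mult_mat[of E n n D n F n] DF by simp
  then show "E * E = E"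
    using DF \<open>E * D = D\<close> by simp
qed

lemmas D_entries = doubly_stochasticD[OF D_ds D]

lemmas E_entries = doubly_stochasticD[OF doubly_stochastic_pow[OF D D_ds, of p] pow_carrier_mat[OF D]]

lemmas F_entries = doubly_stochasticD[OF doubly_stochastic_pow[OF D D_ds, of "p - 1"] pow_carrier_mat[OF D]]

text \<open>With nonnegative entries nothing cancels, so a single positive summand makes the entry
  positive: paths of positive entries compose.\<close>

lemma product_entry_pos:
  assumes "A \<in> carrier_mat n n" "B \<in> carrier_mat n n" "doubly_stochastic A" "doubly_stochastic B"
    and "i < n" "j < n" "k < n" "0 < A $$ (i, j)" "0 < B $$ (j, k)"
  shows "0 < (A * B) $$ (i, k)"
proof -
  have "0 < A $$ (i, j) * B $$ (j, k)"
    using assms by simp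
  also have "\<dots> \<le> (\<Sum>l<n. A $$ (i, l) * B $$ (l, k))"
    using assms doubly_stochasticD(1)[of A n] doubly_stochasticD(1)[of B n]
    by (intro member_le_sum[of j "{..<n}" "\<lambda>l. A $$ (i, l) * B $$ (l, k)"]) auto
  also have "\<dots> = (A * B) $$ (i, k)"
    using index_mult_mat_sum[OF assms(1,2,5,7)] by simp
  finally show ?thesis .
qed

lemma sum_one_pos:
  fixes g :: "nat \<Rightarrow> real"
  assumes "(\<Sum>i<n. g i) = 1"
  obtains i where "i < n" "0 < g i"
  using assms sum_nonpos[of "{..<n}" g] by (metis lessThan_iff not_less not_one_le_zero)

definition eqv :: "nat \<Rightarrow> nat \<Rightarrow> bool" where
  "eqv i j \<longleftrightarrow> 0 < E $$ (i, j)"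

text \<open>Idempotence says that column \<open>k\<close> of \<open>E\<close> is fixed by
  \<open>E\<close>, hence constant along positive entries.\<close>

lemma E_row_eq:
  assumes "i < n" "j < n" "k < n" "eqv i j"
  shows "E $$ (i, k) = E $$ (j, k)"
proof (rule doubly_stochastic_fixed_constant[where x = "\<lambda>l. E $$ (l, k)"])
  have "(\<Sum>j<n. E $$ (i, k) * E $$ (i, j) * E $$ (j, k)) = (E $$ (i, k))\<^sup>2" if "i < n" for i
    using index_mult_mat_sum[of E n n E n i k] E_products(5) assms(3) that
    by (simp add: power2_eq_square mult.assoc flip: sum_distrib_left)
  then show "(\<Sum>i<n. \<Sum>j<n. E $$ (i, k) * E $$ (i, j) * E $$ (j, k)) = (\<Sum>i<n. (E $$ (i, k))\<^sup>2)"
    by simp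
qed (use assms doubly_stochastic_pow[OF D D_ds] in \<open>auto simp: eqv_def\<close>)

text \<open>The mirror image, with row \<open>k\<close> fixed under multiplication from the right;
  hence the swapped summation.\<close>

lemma E_col_eq:
  assumes "i < n" "j < n" "k < n" "eqv i j"
  shows "E $$ (k, i) = E $$ (k, j)"
proof (rule doubly_stochastic_fixed_constant[where x = "\<lambda>l. E $$ (k, l)"])
  have "(\<Sum>i<n. E $$ (k, i) * E $$ (i, j) * E $$ (k, j)) = (E $$ (k, j))\<^sup>2" if "j < n" for j
    using index_mult_mat_sum[of E n n E n k j] E_products(5) assms(3) that
    by (simp add: power2_eq_square flip: sum_distrib_right)
  then show "(\<Sum>i<n. \<Sum>j<n. E $$ (k, i) * E $$ (i, j) * E $$ (k, j)) = (\<Sum>i<n. (E $$ (k, i))\<^sup>2)"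
    by (subst sum.swap) simp
qed (use assms doubly_stochastic_pow[OF D D_ds] in \<open>auto simp: eqv_def\<close>)

text \<open>Column \<open>i\<close> has a positive entry in some row \<open>j\<close>, and rows
  \<open>j\<close> and \<open>i\<close> of \<open>E\<close> agree.\<close>

lemma eqv_refl:
  assumes "i < n"
  shows "eqv i i"
proof -
  obtain j where "j < n" "eqv j i"
    unfolding eqv_def by (rule sum_one_pos[OF E_entries(3)[OF assms]])
  then show ?thesis
    using E_row_eq[of j i i] assms by (simp add: eqv_def)
qed

lemma eqv_sym: "i < n \<Longrightarrow> j < n \<Longrightarrow> eqv i j \<Longrightarrow> eqv j i"
  using E_row_eq[of i j i] eqv_refl[of i] unfolding eqv_def by simp

lemma eqv_trans: "i < n \<Longrightarrow> j < n \<Longrightarrow> k < n \<Longrightarrow> eqv i j \<Longrightarrow> eqv j k \<Longrightarrow> eqv i k"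
  using E_row_eq[of i j k] unfolding eqv_def by simp

text \<open>Inherited from the rows of \<open>E\<close> through \<open>E * D = D\<close>; the column
  version uses \<open>D * E = D\<close>.\<close>

lemma D_row_eq:
  assumes "i < n" "j < n" "k < n" "eqv i j"
  shows "D $$ (i, k) = D $$ (j, k)"
proof -
  have "(E * D) $$ (i, k) = (E * D) $$ (j, k)"
    using assms E_row_eq by (simp add: index_mult_mat_sum[of _ n n _ n] del: index_mult_mat)
  then show ?thesis by (simp add: E_products)
qed

lemma D_col_eq:
  assumes "i < n" "j < n" "k < n" "eqv i j"
  shows "D $$ (k, i) = D $$ (k, j)"
proof -
  have "(D * E) $$ (k, i) = (D * E) $$ (k, j)"
    using assms E_col_eq by (simp add: index_mult_mat_sum[of _ n n _ n] del: index_mult_mat)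
  then show ?thesis by (simp add: E_products)
qed

section \<open>Positive entries of \<open>D\<close> as an injective map on classes\<close>

lemma D_F_pos:
  assumes "i < n" "j < n" "k < n"
  shows "0 < D $$ (i, j) \<Longrightarrow> 0 < F $$ (j, k) \<Longrightarrow> eqv i k"
    and "0 < F $$ (i, j) \<Longrightarrow> 0 < D $$ (j, k) \<Longrightarrow> eqv i k"
proof -
  note ds = D_ds doubly_stochastic_pow[OF D D_ds, of "p - 1"]
  show "eqv i k" if "0 < D $$ (i, j)" "0 < F $$ (j, k)"
    using product_entry_pos[OF D pow_carrier_mat[OF D] ds assms that]
    unfolding eqv_def E_products .
  show "eqv i k" if "0 < F $$ (i, j)" "0 < D $$ (j, k)"
    using product_entry_pos[OF pow_carrier_mat[OF D] D ds(2,1) assms that]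
    unfolding eqv_def E_products .
qed

text \<open>Following \<open>F\<close> from \<open>j\<close> and \<open>k\<close> leads to
  \<open>l\<close> and \<open>l'\<close>, both equivalent to \<open>i\<close>. Their rows in
  \<open>D\<close> agree, so they share a target \<open>m\<close>, and \<open>F * D = E\<close>
  makes both \<open>j\<close> and \<open>k\<close> equivalent to \<open>m\<close>.\<close>

lemma successors_eqv:
  assumes "i < n" "j < n" "k < n" "0 < D $$ (i, j)" "0 < D $$ (i, k)"
  shows "eqv j k"
proof -
  obtain l where l: "l < n" "0 < F $$ (j, l)"
    by (rule sum_one_pos[OF F_entries(2)[OF assms(2)]])
  obtain l' where l': "l' < n" "0 < F $$ (k, l')"
    by (rule sum_one_pos[OF F_entries(2)[OF assms(3)]])
  have "eqv i l" "eqv i l'"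
    using D_F_pos(1)[OF assms(1,2) l(1) assms(4) l(2)]
      D_F_pos(1)[OF assms(1,3) l'(1) assms(5) l'(2)] by simp_all
  then have ll: "eqv l l'"
    using eqv_trans[OF l(1) assms(1) l'(1)] eqv_sym[OF assms(1) l(1)] by simp
  obtain m where m: "m < n" "0 < D $$ (l, m)"
    by (rule sum_one_pos[OF D_entries(2)[OF l(1)]])
  have "0 < D $$ (l', m)"
    using D_row_eq[OF l(1) l'(1) m(1) ll] m(2) by simp
  then have "eqv j m" "eqv k m"
    using D_F_pos(2)[OF assms(2) l(1) m(1) l(2) m(2)]
      D_F_pos(2)[OF assms(3) l'(1) m(1) l'(2)] by simp_all
  then show ?thesis
    using eqv_trans[OF assms(2) m(1) assms(3)] eqv_sym[OF assms(3) m(1)] by simp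
qed

text \<open>The argument for successors run backwards, with columns of \<open>D\<close> in place of
  rows; this yields injectivity on classes.\<close>

lemma predecessors_eqv:
  assumes "i < n" "j < n" "k < n" "0 < D $$ (j, i)" "0 < D $$ (k, i)"
  shows "eqv j k"
proof -
  obtain l where l: "l < n" "0 < F $$ (l, j)"
    by (rule sum_one_pos[OF F_entries(3)[OF assms(2)]])
  obtain l' where l': "l' < n" "0 < F $$ (l', k)"
    by (rule sum_one_pos[OF F_entries(3)[OF assms(3)]])
  have "eqv l i" "eqv l' i"
    using D_F_pos(2)[OF l(1) assms(2,1) l(2) assms(4)]
      D_F_pos(2)[OF l'(1) assms(3,1) l'(2) assms(5)] by simp_all
  then have ll: "eqv l l'"
    using eqv_trans[OF l(1) assms(1) l'(1)] eqv_sym[OF l'(1) assms(1)] by simp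
  obtain m where m: "m < n" "0 < D $$ (m, l)"
    by (rule sum_one_pos[OF D_entries(3)[OF l(1)]])
  have "0 < D $$ (m, l')"
    using D_col_eq[OF l(1) l'(1) m(1) ll] m(2) by simp
  then have "eqv m j" "eqv m k"
    using D_F_pos(1)[OF m(1) l(1) assms(2) m(2) l(2)]
      D_F_pos(1)[OF m(1) l'(1) assms(3) _ l'(2)] by simp_all
  then show ?thesis
    using eqv_trans[OF assms(2) m(1) assms(3)] eqv_sym[OF m(1) assms(2)] by simp
qed

text \<open>An arbitrary representative: by \<open>successors_eqv\<close> its class does not depend
  on the choice.\<close>

definition succ :: "nat \<Rightarrow> nat" where
  "succ i = (SOME j. j < n \<and> 0 < D $$ (i, j))"

lemma succ:
  assumes "i < n"
  shows succ_less: "succ i < n" and D_succ_pos: "0 < D $$ (i, succ i)"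
proof -
  have "\<exists>j. j < n \<and> 0 < D $$ (i, j)"
    using sum_one_pos[OF D_entries(2)[OF assms]] by blast
  then show "succ i < n" "0 < D $$ (i, succ i)"
    unfolding succ_def by (metis (mono_tags, lifting) someI_ex)+
qed

lemma D_pos_iff:
  assumes "i < n" "j < n"
  shows "0 < D $$ (i, j) \<longleftrightarrow> eqv (succ i) j"
proof
  show "eqv (succ i) j" if "0 < D $$ (i, j)"
    using successors_eqv[OF assms(1) succ_less assms(2) D_succ_pos that] assms(1) by blast
  show "0 < D $$ (i, j)" if "eqv (succ i) j"
    using D_col_eq[OF succ_less[OF assms(1)] assms(2,1) that] D_succ_pos[OF assms(1)] by simp
qed

lemma succ_eqv_iff:
  assumes "i < n" "j < n"
  shows "eqv (succ i) (succ j) \<longleftrightarrow> eqv i j"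
proof
  assume "eqv (succ i) (succ j)"
  then have "0 < D $$ (i, succ j)"
    using D_pos_iff assms succ by blast
  then show "eqv i j"
    using predecessors_eqv assms succ by blast
next
  assume "eqv i j"
  then have "0 < D $$ (i, succ j)"
    using D_row_eq assms succ by metis
  then show "eqv (succ i) (succ j)"
    using D_pos_iff assms succ by blast
qed

section \<open>Entries of \<open>D\<close> and the sizes of the classes\<close>

definition cls :: "nat \<Rightarrow> nat set" where
  "cls i = {j. j < n \<and> eqv i j}"

lemma finite_cls [simp]: "finite (cls i)"
  by (simp add: cls_def)

lemma cls_eq: "i < n \<Longrightarrow> j < n \<Longrightarrow> eqv i j \<Longrightarrow> cls i = cls j"
  unfolding cls_def using eqv_sym eqv_trans by blast

lemma card_cls_pos: "i < n \<Longrightarrow> 0 < card (cls i)"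
  using eqv_refl by (auto simp: card_gt_0_iff cls_def)

text \<open>Row \<open>i\<close> is supported on the class of \<open>succ i\<close>, is constant
  there and sums to \<open>1\<close>.\<close>

lemma D_entry:
  assumes "i < n" "j < n"
  shows "D $$ (i, j) = (if eqv (succ i) j then 1 / card (cls (succ i)) else 0)"
proof (cases "eqv (succ i) j")
  case True
  have "1 = (\<Sum>k<n. D $$ (i, k))"
    using D_entries assms by simp
  also have "\<dots> = (\<Sum>k\<in>cls (succ i). D $$ (i, k))"
    using D_pos_iff D_entries(1) assms(1)
    by (intro sum.mono_neutral_right) (auto simp: cls_def less_le)
  also have "\<dots> = (\<Sum>k\<in>cls (succ i). D $$ (i, j))"
  proof (rule sum.cong[OF refl])
    fix k assume "k \<in> cls (succ i)"
    then have "k < n" "eqv k j"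
      using True assms succ eqv_sym eqv_trans unfolding cls_def by blast+
    then show "D $$ (i, k) = D $$ (i, j)"
      using D_col_eq assms by blast
  qed
  also have "\<dots> = card (cls (succ i)) * D $$ (i, j)"
    by simp
  finally show ?thesis
    using True card_cls_pos[OF succ_less[OF assms(1)]]
    by (simp add: eq_divide_eq mult.commute del: card_gt_0_iff card_0_eq)
next
  case False
  then show ?thesis
    using D_pos_iff D_entries(1) assms by (auto simp: less_le)
qed

text \<open>Column \<open>succ i\<close> is supported on the class of \<open>i\<close>, with all
  entries there the reciprocal of the size of the class of \<open>succ i\<close>; its sum is
  \<open>1\<close>.\<close>

lemma card_cls_succ:
  assumes "i < n"
  shows "card (cls (succ i)) = card (cls i)"
proof -
  have "1 = (\<Sum>k<n. D $$ (k, succ i))"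
    using D_entries(3)[OF succ_less[OF assms]] by simp
  also have "\<dots> = (\<Sum>k<n. if k \<in> cls i then 1 / card (cls (succ i)) else 0)"
  proof (rule sum.cong[OF refl])
    fix k assume "k \<in> {..<n}"
    then have k: "k < n" by simp
    have "eqv (succ k) (succ i) \<longleftrightarrow> k \<in> cls i"
      using succ_eqv_iff[OF k assms] k assms eqv_sym by (auto simp: cls_def)
    moreover have "cls (succ k) = cls (succ i)" if "eqv (succ k) (succ i)"
      using that cls_eq succ_less k assms by blast
    ultimately show "D $$ (k, succ i) = (if k \<in> cls i then 1 / card (cls (succ i)) else 0)"
      using D_entry[OF k succ_less[OF assms]] by simp
  qed
  also have "\<dots> = (\<Sum>k\<in>cls i. 1 / card (cls (succ i)))"
    by (rule sum.mono_neutral_cong_right) (auto simp: cls_def)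
  also have "\<dots> = card (cls i) / card (cls (succ i))"
    by simp
  finally show ?thesis
    using card_cls_pos[OF succ_less[OF assms]] by (simp add: field_simps)
qed

section \<open>The orbit of the class of index \<open>0\<close>\<close>

definition orbit :: "nat \<Rightarrow> nat" where
  "orbit k = (succ ^^ k) 0"

lemma orbit_Suc: "orbit (Suc k) = succ (orbit k)"
  by (simp add: orbit_def)

lemma orbit_less: "orbit k < n"
  by (induction k) (use n_pos succ_less in \<open>auto simp: orbit_def\<close>)

lemma orbit_shift: "eqv (orbit (a + c)) (orbit (b + c)) \<longleftrightarrow> eqv (orbit a) (orbit b)"
  by (induction c) (simp_all add: orbit_Suc succ_eqv_iff orbit_less)

lemma card_cls_orbit: "card (cls (orbit k)) = card (cls (orbit 0))"
  by (induction k) (simp_all add: orbit_Suc card_cls_succ orbit_less)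

lemma pow_orbit_pos: "0 < (D ^\<^sub>m k) $$ (orbit 0, orbit k)"
proof (induction k)
  case 0
  then show ?case
    using orbit_less[of 0] carrier_matD(1)[OF D] by simp
next
  case (Suc k)
  then show ?case
    using product_entry_pos[OF pow_carrier_mat[OF D] D doubly_stochastic_pow[OF D D_ds] D_ds
        orbit_less orbit_less succ_less[OF orbit_less] _ D_succ_pos[OF orbit_less]]
    by (simp add: orbit_Suc del: index_mult_mat)
qed

definition period :: nat where
  "period = (LEAST k. 0 < k \<and> eqv (orbit 0) (orbit k))"

text \<open>The path of \<open>p\<close> steps along the orbit gives a positive entry of
  \<open>E\<close>, so the orbit returns to its first class and a least return time exists.\<close>

lemma period: "0 < period" "eqv (orbit 0) (orbit period)"
proof -
  have "0 < p \<and> eqv (orbit 0) (orbit p)"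
    using p_pos pow_orbit_pos by (simp add: eqv_def)
  from LeastI[where P = "\<lambda>k. 0 < k \<and> eqv (orbit 0) (orbit k)", OF this]
  show "0 < period" "eqv (orbit 0) (orbit period)"
    unfolding period_def by auto
qed

lemma orbit_mod_period: "eqv (orbit (k mod period)) (orbit k)"
proof (induction k rule: less_induct)
  case (less k)
  show ?case
  proof (cases "k < period")
    case False
    have "eqv (orbit (k mod period)) (orbit (k - period))"
      using less[of "k - period"] False period(1) by (simp add: le_mod_geq)
    moreover have "eqv (orbit (k - period)) (orbit k)"
      using orbit_shift[of 0 "k - period" period] False period(2) by simp
    ultimately show ?thesis
      using eqv_trans orbit_less by blast
  qed (simp add: eqv_refl orbit_less)
qed

lemma orbit_eqv_iff:
  assumes "a < period" "b < period"
  shows "eqv (orbit a) (orbit b) \<longleftrightarrow> a = b"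
proof -
  have *: "\<not> eqv (orbit a) (orbit b)" if "a < b" "b < period" for a b
  proof
    assume "eqv (orbit a) (orbit b)"
    \<comment> \<open>Injectivity on classes cancels the common \<open>a\<close> steps, giving a
      return earlier than \<open>period\<close>.\<close>
    then have "eqv (orbit 0) (orbit (b - a))"
      using orbit_shift[of 0 a "b - a"] that by simp
    then show False
      using Least_le[where P = "\<lambda>k. 0 < k \<and> eqv (orbit 0) (orbit k)" and k = "b - a"] that
      unfolding period_def by simp
  qed
  then show ?thesis
    using assms eqv_sym[OF orbit_less orbit_less] eqv_refl[OF orbit_less]
    by (metis linorder_neqE_nat)
qed

text \<open>The union of the classes on the orbit is closed under positive entries of
  \<open>D\<close>; a proper union would make \<open>D\<close> reducible.\<close>

lemma orbit_covers:
  assumes "i < n"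
  shows "\<exists>k<period. eqv (orbit k) i"
proof -
  let ?S = "{i. i < n \<and> (\<exists>k<period. eqv (orbit k) i)}"
  have "?S = {..<n}"
  proof (rule ccontr)
    assume neq: "?S \<noteq> {..<n}"
    have "reducible_mat D"
    proof (rule reducible_matI[OF D _ _ neq])
      show "?S \<subseteq> {..<n}" by auto
      have "orbit 0 \<in> ?S"
        using orbit_less[of 0] eqv_refl period(1) by blast
      then show "?S \<noteq> {}" by blast
    next
      fix i j assume "i \<in> ?S" and j: "j < n" "j \<notin> ?S"
      then obtain k where i: "i < n" "k < period" "eqv (orbit k) i" by auto
      have "\<not> eqv (succ i) j"
      proof
        assume "eqv (succ i) j"
        moreover have "eqv (orbit (Suc k)) (succ i)"
          using i succ_eqv_iff orbit_less by (simp add: orbit_Suc)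
        \<comment> \<open>\<open>Suc k\<close> may equal \<open>period\<close>; the reduction wraps
          it to \<open>0\<close> and keeps the witness below \<open>period\<close>.\<close>
        ultimately have "eqv (orbit (Suc k mod period)) j"
          using eqv_trans[OF orbit_less succ_less[OF i(1)] j(1)]
            eqv_trans[OF orbit_less orbit_less j(1) orbit_mod_period] by blast
        then show False
          using j period(1) by auto
      qed
      then show "D $$ (i, j) = 0"
        using D_entry[OF i(1) j(1)] by simp
    qed
    then show False
      using D_irreducible by (simp add: irreducible_mat_def)
  qed
  then show ?thesis
    using assms by blast
qed

lemma permutation_kronecker:
  "\<exists>P d m. permutation_mat n P \<and> 0 < d \<and> 0 < m \<and> n = d * m \<and>
    transpose_mat P * D * P = kronecker_mat (K_mat d) (J_mat m)"
proof -
  define m where "m = card (cls (orbit 0))"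
  have m: "0 < m"
    using card_cls_pos[OF orbit_less] by (simp add: m_def)
  have "\<exists>g. bij_betw g {..<m} (cls (orbit k))" for k
    using ex_bij_betw_nat_finite[of "cls (orbit k)"] card_cls_orbit[of k]
    by (simp add: m_def atLeast0LessThan)
  then obtain g where g: "\<And>k. bij_betw (g k) {..<m} (cls (orbit k))"
    by metis
  \<comment> \<open>Block \<open>k\<close> of \<open>m\<close> consecutive indices enumerates the
    class of \<open>orbit k\<close>. The bound is \<open>period * m\<close>, whose equality with
    \<open>n\<close> is only obtained from the bijectivity below.\<close>
  define \<sigma> where "\<sigma> i = (if i < period * m then g (i div m) (i mod m) else i)" for i
  have \<sigma>_cls: "\<sigma> i < n" "eqv (orbit (i div m)) (\<sigma> i)" if "i < period * m" for i
  proof -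
    have "g (i div m) (i mod m) \<in> cls (orbit (i div m))"
      using g[of "i div m"] m by (auto simp: bij_betw_def)
    then show "\<sigma> i < n" "eqv (orbit (i div m)) (\<sigma> i)"
      using that by (auto simp: \<sigma>_def cls_def)
  qed
  have inj: "inj_on \<sigma> {..<period * m}"
  proof (rule inj_onI)
    fix i j assume "i \<in> {..<period * m}" "j \<in> {..<period * m}" and eq: "\<sigma> i = \<sigma> j"
    then have ij: "i < period * m" "j < period * m" by auto
    have "eqv (orbit (i div m)) (orbit (j div m))"
      using eqv_trans[OF orbit_less \<sigma>_cls(1)[OF ij(2)] orbit_less]
        eqv_sym[OF orbit_less \<sigma>_cls(1)[OF ij(2)] \<sigma>_cls(2)[OF ij(2)]]
        \<sigma>_cls(2)[OF ij(1)] eq by simp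
    then have div: "i div m = j div m"
      using orbit_eqv_iff ij by (simp add: less_mult_imp_div_less)
    then have "g (i div m) (i mod m) = g (i div m) (j mod m)"
      using eq ij by (simp add: \<sigma>_def)
    then have "i mod m = j mod m"
      using g[of "i div m"] m by (auto simp: bij_betw_def inj_on_def)
    then show "i = j"
      using div by (metis div_mult_mod_eq)
  qed
  have surj: "\<sigma> ` {..<period * m} = {..<n}"
  proof (intro equalityI subsetI)
    fix i assume "i \<in> {..<n}"
    then obtain k where k: "k < period" "i \<in> cls (orbit k)"
      using orbit_covers by (auto simp: cls_def)
    then obtain b where b: "b < m" "g k b = i"
      using k(2) unfolding bij_betw_imp_surj_on[OF g, symmetric] by auto
    have "k * m + b < Suc k * m"
      using b by simp
    also have "\<dots> \<le> period * m"
      using k by (intro mult_le_mono1) auto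
    finally show "i \<in> \<sigma> ` {..<period * m}"
      using b by (intro image_eqI[of _ _ "k * m + b"]) (auto simp: \<sigma>_def)
  qed (use \<sigma>_cls in auto)
  have n: "n = period * m"
    using card_image[OF inj] unfolding surj by simp
  have \<sigma>: "\<sigma> permutes {..<n}"
    using inj surj unfolding n[symmetric]
    by (intro bij_imp_permutes) (auto simp: bij_betw_def \<sigma>_def simp flip: n)
  define P where "P = mat n n (\<lambda>(i, j). if i = \<sigma> j then 1 else 0 :: real)"
  have "transpose_mat P * D * P = mat n n (\<lambda>(i, j). D $$ (\<sigma> i, \<sigma> j))"
    by (rule permutation_sandwich[OF \<sigma> D P_def])
  also have "\<dots> = kronecker_mat (K_mat period) (J_mat m)"
  proof (rule eq_matI)
    fix i j assume "i < dim_row (kronecker_mat (K_mat period) (J_mat m))"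
      "j < dim_col (kronecker_mat (K_mat period) (J_mat m))"
    then have ij: "i < period * m" "j < period * m"
      by (auto simp: kronecker_mat_def K_mat_def J_mat_def)
    then have dm: "i div m < period" "j div m < period" "i mod m < m" "j mod m < m"
      using m by (auto simp: less_mult_imp_div_less)
    let ?k = "Suc (i div m) mod period"
    have k: "?k < period"
      using period(1) by simp
    have "eqv (orbit (Suc (i div m))) (succ (\<sigma> i))"
      using \<sigma>_cls[OF ij(1)] succ_eqv_iff orbit_less by (simp add: orbit_Suc)
    then have 1: "eqv (orbit ?k) (succ (\<sigma> i))"
      by (rule eqv_trans[OF orbit_less orbit_less succ_less[OF \<sigma>_cls(1)[OF ij(1)]]
            orbit_mod_period])
    \<comment> \<open>Both indices are exchanged for orbit representatives of their classes, which
      are equivalent only if their positions below \<open>period\<close> coincide.\<close>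
    have "eqv (succ (\<sigma> i)) (\<sigma> j) \<longleftrightarrow> eqv (orbit ?k) (orbit (j div m))"
    proof
      note s = succ_less[OF \<sigma>_cls(1)[OF ij(1)]] and j = \<sigma>_cls[OF ij(2)]
      show "eqv (orbit ?k) (orbit (j div m))" if "eqv (succ (\<sigma> i)) (\<sigma> j)"
        using eqv_trans[OF orbit_less s j(1) 1 that] eqv_trans[OF orbit_less j(1) orbit_less]
          eqv_sym[OF orbit_less j] by blast
      show "eqv (succ (\<sigma> i)) (\<sigma> j)" if "eqv (orbit ?k) (orbit (j div m))"
        using eqv_trans[OF s orbit_less j(1) eqv_sym[OF orbit_less s 1]]
          eqv_trans[OF orbit_less orbit_less j(1) that j(2)] by blast
    qed
    then have 2: "eqv (succ (\<sigma> i)) (\<sigma> j) \<longleftrightarrow> j div m = ?k"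
      using orbit_eqv_iff[OF k dm(2)] by auto
    have 3: "card (cls (succ (\<sigma> i))) = m"
      using cls_eq[OF orbit_less succ_less[OF \<sigma>_cls(1)[OF ij(1)]] 1] card_cls_orbit[of ?k]
      unfolding m_def by simp
    have "D $$ (\<sigma> i, \<sigma> j) = (if j div m = ?k then 1 / m else 0)"
      using D_entry[OF \<sigma>_cls(1)[OF ij(1)] \<sigma>_cls(1)[OF ij(2)]] 2 3 by simp
    also have "\<dots> = kronecker_mat (K_mat period) (J_mat m) $$ (i, j)"
      unfolding index_kronecker[OF K_mat_carrier J_mat_carrier ij]
      using dm by (simp add: index_K_mat J_mat_def)
    finally show "mat n n (\<lambda>(i, j). D $$ (\<sigma> i, \<sigma> j)) $$ (i, j)
        = kronecker_mat (K_mat period) (J_mat m) $$ (i, j)"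
      using ij by (simp flip: n)
  qed (simp_all flip: n add: kronecker_mat_def K_mat_def J_mat_def)
  finally have "transpose_mat P * D * P = kronecker_mat (K_mat period) (J_mat m)" .
  moreover have "permutation_mat n P"
    using \<sigma> by (auto simp: permutation_mat_def P_def)
  ultimately show ?thesis
    using period(1) m n by blast
qed

end

text \<open>Cyclicity yields the normal form with some \<open>d\<close> and \<open>m\<close>, which
  the eigenvalue count identifies as \<open>h\<close> and \<open>n'\<close>. Conversely the normal
  form has order \<open>h\<close>, which also settles the final claim.\<close>

theorem theorem4p7:
  fixes D :: "real mat" and n h n' :: nat
  assumes "0 < n"
    and "D \<in> carrier_mat n n"
    and "doubly_stochastic D"
    and "irreducible_mat D"
    and "h = peripheral_count (map_mat complex_of_real D)"
    and "n' = n div h"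
  shows "(cyclic_mat D \<longleftrightarrow>
           (\<exists>P. permutation_mat n P \<and>
              transpose_mat P * D * P = kronecker_mat (K_mat h) (J_mat n'))) \<and>
         (cyclic_mat D \<longrightarrow> cyclic_mat_of_order D h)"
proof -
  let ?kron = "\<exists>P. permutation_mat n P \<and>
    transpose_mat P * D * P = kronecker_mat (K_mat h) (J_mat n')"
  have "?kron" if "cyclic_mat D"
  proof -
    from that obtain p where p: "cyclic_mat_of_order D p"
      unfolding cyclic_mat_def by blast
    interpret cyclic_doubly_stochastic D n p
      using assms(1-4) p by unfold_locales (auto simp: cyclic_mat_of_order_def)
    obtain P d m where P: "permutation_mat n P" and d: "0 < d" and m: "0 < m" and n: "n = d * m"
      and eq: "transpose_mat P * D * P = kronecker_mat (K_mat d) (J_mat m)"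
      using permutation_kronecker by blast
    have "similar_mat (map_mat complex_of_real D)
        (map_mat complex_of_real (kronecker_mat (K_mat d) (J_mat m)))"
      using similar_mat_wit_of_real[OF permutation_similar[OF P assms(2) eq]]
      unfolding similar_mat_def by (intro exI)
    then have "h = d"
      using peripheral_count_kronecker[OF d m] assms(5) by simp
    moreover have "n' = m"
      using assms(6) n d \<open>h = d\<close> by simp
    ultimately show ?thesis
      using P eq by blast
  qed
  moreover have "cyclic_mat_of_order D h" if ?kron
  proof -
    from that obtain P where P: "permutation_mat n P"
      and eq: "transpose_mat P * D * P = kronecker_mat (K_mat h) (J_mat n')"
      by blast
    \<comment> \<open>Truncating division alone gives neither \<open>h * n' = n\<close> nor
      \<open>0 < h\<close>; comparing the dimensions of both sides gives both.\<close>
    have "dim_row (transpose_mat P * D * P) = n"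
      using P by (auto simp: permutation_mat_def)
    then have "h * n' = n"
      unfolding eq by (simp add: kronecker_mat_def K_mat_def J_mat_def)
    then have "0 < h" "0 < n'"
      using assms(1) by (auto intro: Nat.gr0I)
    then show ?thesis
      using cyclic_kronecker_K_J cyclic_mat_of_order_similar[OF permutation_similar[OF P assms(2) eq]]
      by blast
  qed
  ultimately show ?thesis
    unfolding cyclic_mat_def by blast
qed

end
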